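(* For every $x\in\mathbb S$, the transition rate $q_{\infty x}=\lim_{t\searrow 0}\frac{p_{\infty x}(t)}{t}$ exists in $[0,+\infty]$ and $$q_{\infty x}=\begin{cases}\frac{\lambda_x}{c}&\text{if }c>0,\\ +\infty&\text{if }c=0.\end{cases}$$
   Context: Let $\mathbb S$ be a countably infinite set, $\infty$ a symbol not in $\mathbb S$, and $\bar{\mathbb S}=\mathbb S\cup\{\infty\}$. The parameters are strictly positive reals $\{\gamma_x,\lambda_x:x\in\mathbb S\}$ and a constant $c\ge 0$, with $\sum_{x\in\mathbb S}\lambda_x=\infty$ and $\sum_{x\in\mathbb S}\lambda_x\gamma_x<\infty$; set $\gamma_\infty=0$. On a probability space $(\Omega,\mathcal F,\mathbb P)$ let the following be independent: a family $\{N_x:x\in\mathbb S\}$ of independent Poisson processes on $\mathbb R^+$, $N_x$ of rate $\lambda_x$ with marks $0<\sigma^x_1<\sigma^x_2<\cdots$ ($N_x(t)$ is the number of marks in $[0,t]$), and a family $\{T_0\}\cup\{T^x_n:n\ge 1,x\in\mathbb S\}$ of i.i.d. exponential random variables of rate $1$. Clock process: for $y\in\bar{\mathbb S}$, $t\ge 0$, $\Gamma^y(t)=\gamma_yT_0+\sum_{z\in\mathbb S}\sum_{i=1}^{N_z(t)}\gamma_zT^z_i+ct$ (empty sums are $0$), and $\Gamma^y(s-)$ denotes its left limit at $s$. K process with initial state $y\in\bar{\mathbb S}$: $X^y(t)=y$ if $t<\gamma_yT_0$; $X^y(t)=x$ (with $x\in\mathbb S$) if $t\in\bigcup_{i\ge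 1}[\Gamma^y(\sigma^x_i-),\Gamma^y(\sigma^x_i))$; $X^y(t)=\infty$ otherwise. Transition functions: $p_{xy}(t)=\mathbb P(X^x(t)=y)$ for $x,y\in\bar{\mathbb S}$, $t\ge 0$. (The state $\infty\in\bar{\mathbb S}$ is not to be confused with the value $+\infty$.) *)

theory Defs
  imports "HOL-Probability.Probability"
begin

definition mark_count :: "(nat \<Rightarrow> 'w \<Rightarrow> real) \<Rightarrow> real \<Rightarrow> 'w \<Rightarrow> nat" where
  "mark_count \<sigma> t \<omega> = card {i. 1 \<le> i \<and> \<sigma> i \<omega> \<in> {0..t}}"

text \<open>
  \<open>poisson_marks M r \<sigma>\<close>: the random times \<open>\<sigma> 1 < \<sigma> 2 < \<dots>\<close> are the marks of a Poisson process of
  rate \<open>r\<close> on the half line, that is, the process counting them has independent increments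
  and its increment over \<open>(s, t]\<close> is Poisson with parameter \<open>r * (t - s)\<close>.  The value \<open>\<sigma> 0\<close> is not
  used.  Marks tend to infinity, so \<open>mark_count\<close> is the cardinality of a finite set and is
  nondecreasing in \<open>t\<close>; the truncated subtractions below are therefore genuine differences.
\<close>

definition poisson_marks :: "'w measure \<Rightarrow> real \<Rightarrow> (nat \<Rightarrow> 'w \<Rightarrow> real) \<Rightarrow> bool" where
  "poisson_marks M r \<sigma> \<longleftrightarrow>
     (\<forall>\<omega>\<in>space M. 0 < \<sigma> 1 \<omega> \<and> (\<forall>i\<ge>1. \<sigma> i \<omega> < \<sigma> (Suc i) \<omega>) \<and>
        filterlim (\<lambda>i. \<sigma> i \<omega>) at_top sequentially) \<and>
     (\<forall>t\<ge>0. mark_count \<sigma> t \<in> measurable M (count_space UNIV)) \<and>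
     (\<forall>s t. 0 \<le> s \<longrightarrow> s < t \<longrightarrow>
        distr M (count_space UNIV) (\<lambda>\<omega>. mark_count \<sigma> t \<omega> - mark_count \<sigma> s \<omega>)
          = measure_pmf (poisson_pmf (r * (t - s)))) \<and>
     (\<forall>(u :: nat \<Rightarrow> real) n. 0 \<le> u 0 \<longrightarrow> incseq u \<longrightarrow>
        prob_space.indep_vars M (\<lambda>_. count_space UNIV)
          (\<lambda>k \<omega>. mark_count \<sigma> (u (Suc k)) \<omega> - mark_count \<sigma> (u k) \<omega>) {..<n})"

text \<open>
  The set \<open>\<S>\<close> is the universe of the type \<open>'s\<close>, and \<open>\<S> \<union> {\<infinity>}\<close> is \<open>'s option\<close> with \<open>None\<close> for \<open>\<infinity>\<close>.
  The exponential variables are indexed by \<open>('s \<times> nat) option\<close>: \<open>T None\<close> is \<open>T\<^sub>0\<close> and \<open>T (Some (x, n))\<close>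
  is \<open>T\<^sup>x\<^sub>n\<close>, for \<open>n \<ge> 1\<close>.
\<close>

definition T_index :: "('s \<times> nat) option set" where
  "T_index = insert None {Some (x, n) | x n. 1 \<le> n}"

definition ext_gam :: "('s \<Rightarrow> real) \<Rightarrow> 's option \<Rightarrow> real" where
  "ext_gam \<gamma> y = (case y of None \<Rightarrow> 0 | Some x \<Rightarrow> \<gamma> x)"

text \<open>
  The last assumption is independence of the two families; each of them is regarded as a single
  random element, a family of counting processes and a family of reals respectively.
\<close>

locale K_data = prob_space M
  for M :: "'w measure" +
  fixes \<gamma> lam :: "'s::countable \<Rightarrow> real"
    and c :: real
    and \<sigma> :: "'s \<Rightarrow> nat \<Rightarrow> 'w \<Rightarrow> real"
    and T :: "('s \<times> nat) option \<Rightarrow> 'w \<Rightarrow> real"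
  assumes infinite_S: "infinite (UNIV :: 's set)"
    and gam_pos: "\<And>x. 0 < \<gamma> x"
    and lam_pos: "\<And>x. 0 < lam x"
    and c_nonneg: "0 \<le> c"
    and lam_diverges: "\<not> lam summable_on UNIV"
    and lam_gam_summable: "(\<lambda>x. lam x * \<gamma> x) summable_on UNIV"
    and poisson: "\<And>x. poisson_marks M (lam x) (\<sigma> x)"
    and poisson_indep:
      "indep_vars (\<lambda>_. PiM {0..} (\<lambda>_. count_space UNIV))
         (\<lambda>x \<omega>. \<lambda>t\<in>{0..}. mark_count (\<sigma> x) t \<omega>) UNIV"
    and exponential: "\<And>j. j \<in> T_index \<Longrightarrow> distributed M lborel (T j) (exponential_density 1)"
    and exponential_indep: "indep_vars (\<lambda>_. borel) T T_index"
    and families_indep: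
      "indep_set
         (sets (vimage_algebra (space M) (\<lambda>\<omega> x. \<lambda>t\<in>{0..}. mark_count (\<sigma> x) t \<omega>)
            (PiM UNIV (\<lambda>_. PiM {0..} (\<lambda>_. count_space UNIV)))))
         (sets (vimage_algebra (space M) (\<lambda>\<omega>. \<lambda>j\<in>T_index. T j \<omega>)
            (PiM T_index (\<lambda>_. borel))))"

text \<open>
  The clock takes values in \<open>ennreal\<close> so that the series always has a value; it is finite almost
  surely.  The coercions truncate negative values of the exponential variables, which occur only
  on a null set.
\<close>

definition clock ::
  "('s \<Rightarrow> real) \<Rightarrow> real \<Rightarrow> ('s \<Rightarrow> nat \<Rightarrow> 'w \<Rightarrow> real) \<Rightarrow> (('s \<times> nat) option \<Rightarrow> 'w \<Rightarrow> real)
     \<Rightarrow> 's option \<Rightarrow> 'w \<Rightarrow> real \<Rightarrow> ennreal" where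
  "clock \<gamma> c \<sigma> T y \<omega> t =
     ennreal (ext_gam \<gamma> y * T None \<omega>)
     + (\<Sum>\<^sub>\<infinity>z. \<Sum>i = 1..mark_count (\<sigma> z) t \<omega>. ennreal (\<gamma> z * T (Some (z, i)) \<omega>))
     + ennreal (c * t)"

definition visiting ::
  "('s \<Rightarrow> real) \<Rightarrow> real \<Rightarrow> ('s \<Rightarrow> nat \<Rightarrow> 'w \<Rightarrow> real) \<Rightarrow> (('s \<times> nat) option \<Rightarrow> 'w \<Rightarrow> real)
     \<Rightarrow> 's option \<Rightarrow> 's \<Rightarrow> 'w \<Rightarrow> real set" where
  "visiting \<gamma> c \<sigma> T y x \<omega> =
     {t. \<exists>i\<ge>1. Lim (at_left (\<sigma> x i \<omega>)) (clock \<gamma> c \<sigma> T y \<omega>) \<le> ennreal t \<and>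
              ennreal t < clock \<gamma> c \<sigma> T y \<omega> (\<sigma> x i \<omega>)}"

text \<open>
  For different \<open>x\<close> the sets \<open>visiting \<gamma> c \<sigma> T y x \<omega>\<close> can intersect only if two of the Poisson
  processes have a common mark, which has probability 0.  On this event the value of the process
  is ambiguous, and we set it to \<open>None\<close>; this keeps the process measurable.
\<close>

definition K_process ::
  "('s \<Rightarrow> real) \<Rightarrow> real \<Rightarrow> ('s \<Rightarrow> nat \<Rightarrow> 'w \<Rightarrow> real) \<Rightarrow> (('s \<times> nat) option \<Rightarrow> 'w \<Rightarrow> real)
     \<Rightarrow> 's option \<Rightarrow> real \<Rightarrow> 'w \<Rightarrow> 's option" where
  "K_process \<gamma> c \<sigma> T y t \<omega> =
     (if t < ext_gam \<gamma> y * T None \<omega> then y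
      else if \<exists>!x. t \<in> visiting \<gamma> c \<sigma> T y x \<omega> then Some (THE x. t \<in> visiting \<gamma> c \<sigma> T y x \<omega>)
      else None)"

definition trans_prob ::
  "'w measure \<Rightarrow> ('s \<Rightarrow> real) \<Rightarrow> real \<Rightarrow> ('s \<Rightarrow> nat \<Rightarrow> 'w \<Rightarrow> real) \<Rightarrow> (('s \<times> nat) option \<Rightarrow> 'w \<Rightarrow> real)
     \<Rightarrow> 's option \<Rightarrow> 's option \<Rightarrow> real \<Rightarrow> real" where
  "trans_prob M \<gamma> c \<sigma> T x y t = measure M {\<omega> \<in> space M. K_process \<gamma> c \<sigma> T x t \<omega> = y}"

definition rate_from_infinity ::
  "'w measure \<Rightarrow> ('s \<Rightarrow> real) \<Rightarrow> real \<Rightarrow> ('s \<Rightarrow> nat \<Rightarrow> 'w \<Rightarrow> real) \<Rightarrow> (('s \<times> nat) option \<Rightarrow> 'w \<Rightarrow> real)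
     \<Rightarrow> 's \<Rightarrow> ennreal" where
  "rate_from_infinity M \<gamma> c \<sigma> T x =
     Lim (at_right 0) (\<lambda>t. ennreal (trans_prob M \<gamma> c \<sigma> T None (Some x) t / t))"

end

theory Submission
  imports Defs "HOL-Real_Asymp.Real_Asymp"
begin

text \<open>
  Started from \<open>\<infinity>\<close>, the process is almost surely at \<open>x\<close> at time \<open>t > 0\<close> if and only if the clock
  jumps over \<open>t\<close> at a mark of \<open>N x\<close>, the Poisson process of \<open>x\<close>.  For small \<open>t\<close> only the first mark
  of \<open>N x\<close> matters, and before that mark the clock behaves like its drift: the jumps made by the
  other states during \<open>[0, u]\<close> add up to \<open>o(u)\<close> in probability, although infinitely many of them
  occur.  So, if \<open>c > 0\<close>, the clock jumps over \<open>t\<close> at a mark of \<open>x\<close> essentially when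
  \<open>\<sigma> x 1 \<le> t / c\<close>, an event of probability about \<open>lam x * t / c\<close>.

  The upper bound (\<open>trans_prob_le\<close>) concerns \<open>c > 0\<close>: the clock runs at least at speed \<open>c\<close>, so a visit
  of \<open>x\<close> at time \<open>t\<close> forces a mark of \<open>x\<close> in \<open>[0, t / c]\<close>.

  For the lower bound (\<open>trans_prob_ge\<close>) let \<open>\<epsilon> > 0\<close> and \<open>u = t / (c + \<epsilon>)\<close>.  If \<open>N x\<close> has a mark in
  \<open>[0, u]\<close>, if the first jump of \<open>x\<close> exceeds \<open>t\<close>, if the other states contribute at most \<open>\<epsilon> * u\<close>
  to the clock at \<open>u\<close>, and if no mark of \<open>x\<close> is a mark of another state, then the process is at
  \<open>x\<close> at time \<open>t\<close> (\<open>visits_x\<close>).  The last condition holds almost surely (\<open>AE_no_common_mark\<close>).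
  The first one has probability \<open>1 - exp (- (lam x * u))\<close>, and each of the other two fails, given
  the first, with small probability.  The first jump is at most \<open>t\<close> with probability
  \<open>1 - exp (- (t / \<gamma> x))\<close>.  The other states are split into a finite set \<open>F\<close> and the rest: states
  in \<open>F\<close> have a mark in \<open>[0, u]\<close> with probability \<open>O(u)\<close> only, and the expected contribution of
  the rest is at most \<open>\<delta> * u\<close>, so that it exceeds \<open>\<epsilon> * u\<close> with probability at most \<open>\<delta> / \<epsilon>\<close> by
  Markov's inequality.  As \<open>lam z * \<gamma> z\<close> is summable over \<open>z\<close>, the set \<open>F\<close> can be chosen for
  \<open>\<delta> = \<epsilon>\<^sup>2\<close>.  Then the lower limit of \<open>p(t) / t\<close> is at least \<open>lam x * (1 - \<epsilon>) / (c + \<epsilon>)\<close>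
  (\<open>eventually_trans_prob_gt\<close>).  As \<open>\<epsilon>\<close> tends to \<open>0\<close> this tends to \<open>lam x / c\<close> if \<open>c > 0\<close> and to
  infinity if \<open>c = 0\<close>, so the two cases of the theorem share one argument.

  The failure probabilities are computed from pairs of states only: independence is used for two
  counting processes at a time, and for an event of the counting family against a single
  holding time.
\<close>

section \<open>Monotone functions and sums in the extended nonnegative reals\<close>

text \<open>
  The left limit of a monotone function is a supremum.  In this form it disappears from the
  definition of the visiting sets.
\<close>

lemma Lim_at_left_le_iff:
  fixes f :: "real \<Rightarrow> ennreal"
  assumes "mono f"
  shows "Lim (at_left s) f \<le> a \<longleftrightarrow> (\<forall>r<s. f r \<le> a)"
proof -
  have "(f \<longlongrightarrow> (SUP r\<in>{..<s}. f r)) (at_left s)"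
  proof (rule order_tendstoI)
    fix b assume "b < (SUP r\<in>{..<s}. f r)"
    then obtain r where "r < s" "b < f r" by (auto simp: less_SUP_iff)
    then show "eventually (\<lambda>y. b < f y) (at_left s)"
      using monoD[OF assms] by (intro eventually_at_leftI[of r]) (auto intro: less_le_trans)
  next
    fix b assume b: "(SUP r\<in>{..<s}. f r) < b"
    have "f y < b" if "y < s" for y
      using b that by (meson SUP_upper lessThan_iff le_less_trans)
    then show "eventually (\<lambda>y. f y < b) (at_left s)"
      by (intro eventually_at_leftI[of "s - 1"]) auto
  qed
  then have "Lim (at_left s) f = (SUP r\<in>{..<s}. f r)"
    by (intro tendsto_Lim) auto
  then show ?thesis by (auto simp: SUP_le_iff)
qed

text \<open>
  Replaces an uncountable family of conditions on the clock by a countable one, which makes the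
  visiting events measurable.
\<close>

lemma all_less_iff_rat:
  assumes "mono f"
  shows "(\<forall>r<s. f r \<le> (a :: ennreal)) \<longleftrightarrow> (\<forall>q. of_rat q < (s :: real) \<longrightarrow> f (of_rat q) \<le> a)"
proof (intro iffI allI impI)
  fix r assume *: "\<forall>q. of_rat q < s \<longrightarrow> f (of_rat q) \<le> a" and "r < s"
  then obtain q where "r < of_rat q" "of_rat q < s" using of_rat_dense by blast
  then show "f r \<le> a" using * monoD[OF assms, of r "of_rat q"] by fastforce
qed auto

text \<open>
  Enumerating a countably infinite index type gives unordered sums access to monotone
  convergence, which is available for series.
\<close>

lemma infsum_ennreal_suminf:
  fixes f :: "'s::countable \<Rightarrow> ennreal"
  assumes "infinite (UNIV :: 's set)"
  shows "infsum f UNIV = (\<Sum>n. f (from_nat_into UNIV n))"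
proof -
  have "bij_betw (from_nat_into (UNIV :: 's set)) UNIV UNIV"
    by (intro bij_betw_from_nat_into assms) auto
  then have "infsum f UNIV = infsum (\<lambda>n. f (from_nat_into UNIV n)) UNIV"
    by (rule infsum_reindex_bij_betw[symmetric])
  also have "\<dots> = (\<Sum>n. f (from_nat_into UNIV n))"
  proof (rule sums_unique)
    show "(\<lambda>n. f (from_nat_into UNIV n)) sums infsum (\<lambda>n. f (from_nat_into UNIV n)) UNIV"
      using has_sum_infsum[OF nonneg_summable_on_complete, of UNIV "\<lambda>n. f (from_nat_into UNIV n)", OF zero_le]
      unfolding sums_def has_sum_def by (rule filterlim_compose[OF _ filterlim_lessThan_at_top])
  qed
  finally show ?thesis .
qed

lemma borel_measurable_infsum_ennreal:
  fixes f :: "'s::countable \<Rightarrow> 'w \<Rightarrow> ennreal"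
  assumes "infinite (UNIV :: 's set)" "\<And>z. f z \<in> borel_measurable M"
  shows "(\<lambda>\<omega>. \<Sum>\<^sub>\<infinity>z. f z \<omega>) \<in> borel_measurable M"
  unfolding infsum_ennreal_suminf[OF assms(1)] using assms(2) by simp

lemma nn_integral_infsum:
  fixes f :: "'s::countable \<Rightarrow> 'w \<Rightarrow> ennreal"
  assumes "infinite (UNIV :: 's set)" "\<And>z. f z \<in> borel_measurable M"
  shows "(\<integral>\<^sup>+\<omega>. (\<Sum>\<^sub>\<infinity>z. f z \<omega>) \<partial>M) = (\<Sum>\<^sub>\<infinity>z. \<integral>\<^sup>+\<omega>. f z \<omega> \<partial>M)"
  unfolding infsum_ennreal_suminf[OF assms(1)] using assms(2) by (simp add: nn_integral_suminf)

lemma infsum_ennreal_le: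
  fixes f :: "'s \<Rightarrow> ennreal"
  assumes "\<And>H. finite H \<Longrightarrow> sum f H \<le> b"
  shows "infsum f UNIV \<le> b"
  using assms by (auto simp: nonneg_infsum_complete intro!: SUP_least)

lemma le_infsum_ennreal:
  fixes f :: "'s \<Rightarrow> ennreal"
  shows "f z \<le> infsum f UNIV"
  by (subst nonneg_infsum_complete) (auto intro!: SUP_upper2[of "{z}"])

text \<open>
  With \<open>n\<close> the number of marks of a state, each term of the series depends on one holding time and
  one counting event, so that its expectation factors.
\<close>

lemma sum_atLeast1_conv_suminf:
  fixes f :: "nat \<Rightarrow> ennreal"
  shows "(\<Sum>i = 1..n. f i) = (\<Sum>k. if Suc k \<le> n then f (Suc k) else 0)"
proof -
  have "(\<Sum>k. if Suc k \<le> n then f (Suc k) else 0) = (\<Sum>k<n. if Suc k \<le> n then f (Suc k) else 0)"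
    by (rule suminf_finite) auto
  also have "\<dots> = (\<Sum>i = 1..n. f i)"
    by (simp add: sum.atLeast1_atMost_eq)
  finally show ?thesis ..
qed

section \<open>Expectations: the Poisson mean and independent factors\<close>

lemma nn_integral_poisson_pmf:
  assumes "0 < r"
  shows "(\<integral>\<^sup>+n. of_nat n \<partial>measure_pmf (poisson_pmf r)) = ennreal r"
proof -
  have a: "(\<lambda>n. r * exp (- r) * (r ^ n /\<^sub>R fact n)) sums (r * exp (- r) * exp r)"
    by (intro sums_mult exp_converges)
  have b: "r * exp (- r) * (r ^ n /\<^sub>R fact n) = real (Suc n) * pmf (poisson_pmf r) (Suc n)" for n
    using assms by (simp add: divide_simps del: of_nat_Suc)
  have d: "r * exp (- r) * exp r = r"
    by (simp add: exp_minus)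
  have "(\<lambda>n. real (Suc n) * pmf (poisson_pmf r) (Suc n)) sums r"
    using a unfolding b d .
  then have s: "(\<lambda>n. real n * pmf (poisson_pmf r) n) sums r"
    using sums_Suc_iff[of "\<lambda>n. real n * pmf (poisson_pmf r) n" r]
    by (simp del: of_nat_Suc pmf_poisson)
  have "(\<integral>\<^sup>+n. of_nat n \<partial>measure_pmf (poisson_pmf r)) = (\<Sum>n. ennreal (real n * pmf (poisson_pmf r) n))"
    by (simp add: nn_integral_measure_pmf nn_integral_count_space_nat ennreal_of_nat_eq_real_of_nat
        ennreal_mult mult.commute del: pmf_poisson)
  also have "\<dots> = ennreal r"
    using s assms by (subst suminf_ennreal2) (auto simp: sums_iff)
  finally show ?thesis .
qed

text \<open>
  The product rule for an event and an independent nonnegative function, by the usual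
  approximation from indicators.  Independence is phrased with \<open>\<sigma>\<close>-algebras, as it is given for the
  two families.
\<close>

lemma (in prob_space) nn_integral_indicator_mult_indep:
  fixes Y :: "'a \<Rightarrow> ennreal"
  assumes ind: "indep_set \<A> (sets \<B>)" and "A \<in> \<A>" and "space \<B> = space M"
    and Y: "Y \<in> borel_measurable \<B>"
  shows "(\<integral>\<^sup>+\<omega>. indicator A \<omega> * Y \<omega> \<partial>M) = emeasure M A * (\<integral>\<^sup>+\<omega>. Y \<omega> \<partial>M)"
proof -
  have B: "sets \<B> \<subseteq> events" and A: "A \<in> events"
    using indep_setD_ev1[OF ind] indep_setD_ev2[OF ind] assms(2) by auto
  have M: "measurable \<B> N \<subseteq> measurable M N" for N :: "ennreal measure"
    using B assms(3) by (auto simp: measurable_def)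
  show ?thesis
    using Y
  proof (induction rule: borel_measurable_induct)
    case (cong f g)
    have "f \<omega> = g \<omega>" if "\<omega> \<in> space M" for \<omega> using cong(3) that assms(3) by auto
    then have "(\<integral>\<^sup>+\<omega>. indicator A \<omega> * f \<omega> \<partial>M) = (\<integral>\<^sup>+\<omega>. indicator A \<omega> * g \<omega> \<partial>M)"
      "(\<integral>\<^sup>+\<omega>. f \<omega> \<partial>M) = (\<integral>\<^sup>+\<omega>. g \<omega> \<partial>M)"
      by (auto intro!: nn_integral_cong)
    then show ?case using cong(4) by simp
  next
    case (set B')
    then have "B' \<in> events" using B by auto
    have "(\<integral>\<^sup>+\<omega>. indicator A \<omega> * indicator B' \<omega> \<partial>M) = (\<integral>\<^sup>+\<omega>. indicator (A \<inter> B') \<omega> \<partial>M)"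
      by (intro nn_integral_cong) (simp add: indicator_inter_arith)
    also have "\<dots> = emeasure M A * emeasure M B'"
      using A \<open>B' \<in> events\<close> indep_setD[OF ind assms(2) set]
      by (simp add: emeasure_eq_measure ennreal_mult)
    finally show ?case using \<open>B' \<in> events\<close> by simp
  next
    case (mult u k)
    then have [measurable]: "u \<in> borel_measurable M" using M by auto
    note [measurable] = A
    show ?case using mult.IH
      by (simp add: nn_integral_cmult mult.left_commute[of _ k])
  next
    case (add u v)
    then have [measurable]: "u \<in> borel_measurable M" "v \<in> borel_measurable M"
      using M[of borel] by blast+
    note [measurable] = A
    show ?case using add.IH by (simp add: nn_integral_add distrib_left)
  next
    case (seq U)
    then have [measurable]: "\<And>i. U i \<in> borel_measurable M"
      using M[of borel] by blast
    note [measurable] = A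
    have "(\<integral>\<^sup>+\<omega>. indicator A \<omega> * Sup (range U) \<omega> \<partial>M) = (\<integral>\<^sup>+\<omega>. (SUP i. indicator A \<omega> * U i \<omega>) \<partial>M)"
      by (simp add: SUP_mult_left_ennreal image_comp)
    also have "\<dots> = (SUP i. \<integral>\<^sup>+\<omega>. indicator A \<omega> * U i \<omega> \<partial>M)"
      using seq(3) by (intro nn_integral_monotone_convergence_SUP)
        (auto simp: incseq_def le_fun_def intro!: mult_left_mono)
    also have "\<dots> = (SUP i. emeasure M A * \<integral>\<^sup>+\<omega>. U i \<omega> \<partial>M)"
      using seq.IH by simp
    also have "\<dots> = emeasure M A * (SUP i. \<integral>\<^sup>+\<omega>. U i \<omega> \<partial>M)"
      by (simp add: SUP_mult_left_ennreal)
    also have "(SUP i. \<integral>\<^sup>+\<omega>. U i \<omega> \<partial>M) = (\<integral>\<^sup>+\<omega>. (SUP i. U i \<omega>) \<partial>M)"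
      using seq(3) by (intro nn_integral_monotone_convergence_SUP[symmetric]) auto
    also have "\<dots> = (\<integral>\<^sup>+\<omega>. Sup (range U) \<omega> \<partial>M)"
      by (intro nn_integral_cong) (simp add: image_comp)
    finally show ?case .
  qed
qed

section \<open>Marks and counting process of a Poisson process\<close>

text \<open>
  The following facts concern one Poisson process.  They translate between its marks and its counts:
  events about marks become measurable through the counts, and the probabilities come from the
  distribution of the increments.
\<close>

context
  fixes M :: "'w measure" and r :: real and \<sigma> :: "nat \<Rightarrow> 'w \<Rightarrow> real"
  assumes P: "poisson_marks M r \<sigma>"
begin

lemma marks_strict_mono:
  assumes "\<omega> \<in> space M" "1 \<le> i" "i < j"
  shows "\<sigma> i \<omega> < \<sigma> j \<omega>"
  using assms(3)
proof (induction j)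
  case (Suc j)
  have "\<sigma> j \<omega> < \<sigma> (Suc j) \<omega>" if "1 \<le> j"
    using P assms(1) that by (auto simp: poisson_marks_def)
  then show ?case using Suc assms(2) by (cases "i = j") force+
qed simp

lemma marks_le_iff:
  assumes "\<omega> \<in> space M" "1 \<le> i" "1 \<le> j"
  shows "\<sigma> i \<omega> \<le> \<sigma> j \<omega> \<longleftrightarrow> i \<le> j"
  using marks_strict_mono[OF assms(1,2), of j] marks_strict_mono[OF assms(1,3), of i]
  by (cases i j rule: linorder_cases) auto

lemma marks_pos:
  assumes "\<omega> \<in> space M" "1 \<le> i"
  shows "0 < \<sigma> i \<omega>"
proof -
  have "0 < \<sigma> 1 \<omega>" using P assms by (auto simp: poisson_marks_def)
  also have "\<dots> \<le> \<sigma> i \<omega>" using assms by (subst marks_le_iff) auto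
  finally show ?thesis .
qed

text \<open>
  The marks are increasing and tend to infinity, so those up to time \<open>t\<close> are an initial segment of
  the indices; its length is the count.
\<close>

lemma le_mark_count_iff:
  assumes "\<omega> \<in> space M" "1 \<le> i"
  shows "i \<le> mark_count \<sigma> t \<omega> \<longleftrightarrow> \<sigma> i \<omega> \<le> t"
proof -
  define S where "S = {i. 1 \<le> i \<and> \<sigma> i \<omega> \<in> {0..t}}"
  have S: "k \<in> S \<longleftrightarrow> 1 \<le> k \<and> \<sigma> k \<omega> \<le> t" for k
    using marks_pos[OF assms(1), of k] by (auto simp: S_def)
  \<comment> \<open>Finiteness is essential: an infinite set would have cardinality 0.\<close>
  have "filterlim (\<lambda>i. \<sigma> i \<omega>) at_top sequentially"
    using P assms by (auto simp: poisson_marks_def)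
  then have "eventually (\<lambda>i. t < \<sigma> i \<omega>) sequentially"
    by (auto simp: filterlim_at_top_dense)
  then obtain n0 where "\<And>i. n0 \<le> i \<Longrightarrow> t < \<sigma> i \<omega>"
    by (auto simp: eventually_sequentially)
  then have "S \<subseteq> {..n0}" using S by (meson atMost_iff leD linear subsetI)
  then have fin: "finite S" by (rule finite_subset) simp
  have card: "mark_count \<sigma> t \<omega> = card S" by (simp add: mark_count_def S_def)
  show ?thesis
  proof
    assume *: "\<sigma> i \<omega> \<le> t"
    have "\<sigma> k \<omega> \<le> t" if "1 \<le> k" "k \<le> i" for k
      using that marks_le_iff[OF assms(1) that(1) assms(2)] * by simp
    then have "{1..i} \<subseteq> S" by (auto simp: S)
    from card_mono[OF fin this] show "i \<le> mark_count \<sigma> t \<omega>" by (simp add: card)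
  next
    assume "i \<le> mark_count \<sigma> t \<omega>"
    show "\<sigma> i \<omega> \<le> t"
    proof (rule ccontr)
      assume *: "\<not> \<sigma> i \<omega> \<le> t"
      have "k < i" if "k \<in> S" for k
        using that * marks_le_iff[OF assms, of k] by (force simp: S)
      then have "S \<subseteq> {1..<i}" by (auto simp: S)
      from card_mono[OF _ this] show False
        using \<open>i \<le> mark_count \<sigma> t \<omega>\<close> assms by (auto simp: card)
    qed
  qed
qed

lemma mark_count_mono:
  assumes "\<omega> \<in> space M" "s \<le> t"
  shows "mark_count \<sigma> s \<omega> \<le> mark_count \<sigma> t \<omega>"
proof (cases "mark_count \<sigma> s \<omega> = 0")
  case False
  then show ?thesis
    using le_mark_count_iff[OF assms(1), of "mark_count \<sigma> s \<omega>" s] assms(2)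
      le_mark_count_iff[OF assms(1), of "mark_count \<sigma> s \<omega>" t] by simp
qed simp

lemma mark_count_0:
  assumes "\<omega> \<in> space M"
  shows "mark_count \<sigma> 0 \<omega> = 0"
  using le_mark_count_iff[OF assms, of 1 0] marks_pos[OF assms, of 1] by force

lemma measurable_marks:
  assumes "1 \<le> i"
  shows "\<sigma> i \<in> borel_measurable M"
  unfolding borel_measurable_iff_le
proof
  fix a
  show "{\<omega> \<in> space M. \<sigma> i \<omega> \<le> a} \<in> sets M"
  proof (cases "0 \<le> a")
    case True
    then have [measurable]: "mark_count \<sigma> a \<in> measurable M (count_space UNIV)"
      using P by (auto simp: poisson_marks_def)
    have "{\<omega> \<in> space M. i \<le> mark_count \<sigma> a \<omega>} \<in> sets M" by measurable
    then show ?thesis using assms by (simp add: le_mark_count_iff cong: conj_cong)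
  next
    case False
    then have "\<not> \<sigma> i \<omega> \<le> a" if "\<omega> \<in> space M" for \<omega>
      using marks_pos[OF that assms] by simp
    then have "{\<omega> \<in> space M. \<sigma> i \<omega> \<le> a} = {}" by blast
    then show ?thesis by (simp only: sets.empty_sets)
  qed
qed

text \<open>
  Random times \<open>\<tau>\<close> are allowed because the clock has to be evaluated at the marks.
\<close>

lemma measurable_mark_count:
  assumes [measurable]: "\<tau> \<in> borel_measurable M"
  shows "(\<lambda>\<omega>. mark_count \<sigma> (\<tau> \<omega>) \<omega>) \<in> measurable M (count_space UNIV)"
  unfolding mark_count_def
proof (rule measurable_card)
  fix i
  show "{\<omega> \<in> space M. i \<in> {i. 1 \<le> i \<and> \<sigma> i \<omega> \<in> {0..\<tau> \<omega>}}} \<in> sets M"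
  proof (cases "1 \<le> i")
    case True
    note [measurable] = measurable_marks[OF this]
    show ?thesis using True by simp measurable
  qed simp
qed

lemma prob_increment_pos:
  assumes "0 \<le> s" "s < t" "0 < r" "prob_space M"
  shows "measure M {\<omega> \<in> space M. 1 \<le> mark_count \<sigma> t \<omega> - mark_count \<sigma> s \<omega>} = 1 - exp (- (r * (t - s)))"
    and "measure M {\<omega> \<in> space M. 1 \<le> mark_count \<sigma> t \<omega> - mark_count \<sigma> s \<omega>} \<le> r * (t - s)"
proof -
  interpret prob_space M by fact
  have [measurable]: "mark_count \<sigma> a \<in> measurable M (count_space UNIV)" for a
    using measurable_mark_count[of "\<lambda>_. a"] by simp
  have d: "distr M (count_space UNIV) (\<lambda>\<omega>. mark_count \<sigma> t \<omega> - mark_count \<sigma> s \<omega>)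
          = measure_pmf (poisson_pmf (r * (t - s)))"
    using P assms unfolding poisson_marks_def by blast
  have "prob {\<omega> \<in> space M. 1 \<le> mark_count \<sigma> t \<omega> - mark_count \<sigma> s \<omega>}
      = measure (distr M (count_space UNIV) (\<lambda>\<omega>. mark_count \<sigma> t \<omega> - mark_count \<sigma> s \<omega>)) (- {0})"
    by (subst measure_distr) (auto intro!: arg_cong[where f = prob])
  also have "\<dots> = 1 - exp (- (r * (t - s)))"
    unfolding d using assms measure_pmf.prob_compl[of "{0}" "poisson_pmf (r * (t - s))"]
    by (simp add: measure_pmf_single Compl_eq_Diff_UNIV)
  finally show *: "prob {\<omega> \<in> space M. 1 \<le> mark_count \<sigma> t \<omega> - mark_count \<sigma> s \<omega>}
      = 1 - exp (- (r * (t - s)))" .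
  show "prob {\<omega> \<in> space M. 1 \<le> mark_count \<sigma> t \<omega> - mark_count \<sigma> s \<omega>} \<le> r * (t - s)"
    unfolding * using exp_ge_add_one_self[of "- (r * (t - s))"] by linarith
qed

lemma prob_mark_count_pos:
  assumes "0 < t" "0 < r" "prob_space M"
  shows "measure M {\<omega> \<in> space M. 1 \<le> mark_count \<sigma> t \<omega>} = 1 - exp (- (r * t))"
proof -
  have "{\<omega> \<in> space M. 1 \<le> mark_count \<sigma> t \<omega>} = {\<omega> \<in> space M. 1 \<le> mark_count \<sigma> t \<omega> - mark_count \<sigma> 0 \<omega>}"
    by (auto simp: mark_count_0)
  then show ?thesis using prob_increment_pos(1)[of 0 t] assms by simp
qed

lemma nn_integral_mark_count:
  assumes "0 < t" "0 < r"
  shows "(\<integral>\<^sup>+\<omega>. of_nat (mark_count \<sigma> t \<omega>) \<partial>M) = ennreal (r * t)"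
proof -
  have [measurable]: "mark_count \<sigma> s \<in> measurable M (count_space UNIV)" for s
    using measurable_mark_count[of "\<lambda>_. s"] by simp
  have d: "distr M (count_space UNIV) (\<lambda>\<omega>. mark_count \<sigma> t \<omega> - mark_count \<sigma> 0 \<omega>)
          = measure_pmf (poisson_pmf (r * (t - 0)))"
    using P assms(1) unfolding poisson_marks_def by blast
  have "(\<integral>\<^sup>+\<omega>. of_nat (mark_count \<sigma> t \<omega>) \<partial>M) = (\<integral>\<^sup>+\<omega>. of_nat (mark_count \<sigma> t \<omega> - mark_count \<sigma> 0 \<omega>) \<partial>M)"
    by (intro nn_integral_cong) (simp add: mark_count_0)
  also have "\<dots> = (\<integral>\<^sup>+n. of_nat n \<partial>distr M (count_space UNIV) (\<lambda>\<omega>. mark_count \<sigma> t \<omega> - mark_count \<sigma> 0 \<omega>))"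
    by (subst nn_integral_distr) auto
  also have "\<dots> = ennreal (r * t)"
    unfolding d using assms by (subst nn_integral_poisson_pmf) auto
  finally show ?thesis .
qed

end

section \<open>The clock, the visits and their measurability\<close>

context K_data
begin

abbreviation N :: "'s \<Rightarrow> real \<Rightarrow> 'w \<Rightarrow> nat" where
  "N z \<equiv> mark_count (\<sigma> z)"

abbreviation Gam :: "'w \<Rightarrow> real \<Rightarrow> ennreal" where
  "Gam \<equiv> clock \<gamma> c \<sigma> T None"

definition jumps :: "'s \<Rightarrow> real \<Rightarrow> 'w \<Rightarrow> ennreal" where
  "jumps z t \<omega> = (\<Sum>i = 1..N z t \<omega>. ennreal (\<gamma> z * T (Some (z, i)) \<omega>))"

lemma clock_None: "Gam \<omega> t = (\<Sum>\<^sub>\<infinity>z. jumps z t \<omega>) + ennreal (c * t)"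
  by (simp add: clock_def jumps_def ext_gam_def)

lemma jumps_mono:
  assumes "\<omega> \<in> space M" "s \<le> t"
  shows "jumps z s \<omega> \<le> jumps z t \<omega>"
  unfolding jumps_def using mark_count_mono[OF poisson assms]
  by (intro sum_mono2) auto

lemma clock_mono:
  assumes "\<omega> \<in> space M"
  shows "mono (Gam \<omega>)"
  unfolding clock_None using jumps_mono[OF assms] c_nonneg
  by (intro monoI add_mono infsum_mono ennreal_leI mult_left_mono nonneg_summable_on_complete) auto

lemma measurable_N [measurable (raw)]:
  assumes "\<tau> \<in> borel_measurable M"
  shows "(\<lambda>\<omega>. N z (\<tau> \<omega>) \<omega>) \<in> measurable M (count_space UNIV)"
  by (rule measurable_mark_count[OF poisson assms])

lemma measurable_T [measurable]:
  assumes "1 \<le> i"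
  shows "T (Some (z, i)) \<in> borel_measurable M"
  using distributed_measurable[OF exponential[of "Some (z, i)"]] assms by (auto simp: T_index_def)

lemma measurable_jumps [measurable (raw)]:
  assumes [measurable]: "\<tau> \<in> borel_measurable M"
  shows "(\<lambda>\<omega>. jumps z (\<tau> \<omega>) \<omega>) \<in> borel_measurable M"
  unfolding jumps_def
  by (rule measurable_compose_countable[where g = "\<lambda>\<omega>. N z (\<tau> \<omega>) \<omega>"
      and f = "\<lambda>n \<omega>. \<Sum>i = 1..n. ennreal (\<gamma> z * T (Some (z, i)) \<omega>)"]) auto

lemma measurable_clock [measurable (raw)]:
  assumes [measurable]: "\<tau> \<in> borel_measurable M"
  shows "(\<lambda>\<omega>. Gam \<omega> (\<tau> \<omega>)) \<in> borel_measurable M"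
proof -
  have [measurable]: "(\<lambda>\<omega>. \<Sum>\<^sub>\<infinity>z. jumps z (\<tau> \<omega>) \<omega>) \<in> borel_measurable M"
    by (intro borel_measurable_infsum_ennreal infinite_S) measurable
  show ?thesis unfolding clock_None by measurable
qed

lemma visiting_iff:
  assumes "\<omega> \<in> space M"
  shows "t \<in> visiting \<gamma> c \<sigma> T None z \<omega> \<longleftrightarrow>
    (\<exists>i\<ge>1. (\<forall>r<\<sigma> z i \<omega>. Gam \<omega> r \<le> ennreal t) \<and> ennreal t < Gam \<omega> (\<sigma> z i \<omega>))"
  by (simp add: visiting_def Lim_at_left_le_iff[OF clock_mono[OF assms]])

lemma visiting_measurable [measurable]:
  "Measurable.pred M (\<lambda>\<omega>. t \<in> visiting \<gamma> c \<sigma> T None z \<omega>)"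
proof -
  have [measurable]: "Measurable.pred M (\<lambda>\<omega>. 1 \<le> i \<and>
      (\<forall>q. of_rat q < \<sigma> z i \<omega> \<longrightarrow> Gam \<omega> (of_rat q) \<le> ennreal t) \<and> ennreal t < Gam \<omega> (\<sigma> z i \<omega>))" for i
  proof (cases "1 \<le> i")
    case True
    note [measurable] = measurable_marks[OF poisson True]
    show ?thesis by measurable
  qed simp
  have "Measurable.pred M (\<lambda>\<omega>. \<exists>i. 1 \<le> i \<and>
      (\<forall>q. of_rat q < \<sigma> z i \<omega> \<longrightarrow> Gam \<omega> (of_rat q) \<le> ennreal t) \<and> ennreal t < Gam \<omega> (\<sigma> z i \<omega>))"
    by (intro pred_intros_countable) fact
  then show ?thesis
    by (rule measurable_cong[THEN iffD2, rotated])
       (auto simp: visiting_iff all_less_iff_rat[OF clock_mono] Bex_def)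
qed

lemma K_process_eq_Some_iff:
  assumes "0 \<le> t"
  shows "K_process \<gamma> c \<sigma> T None t \<omega> = Some z \<longleftrightarrow>
    t \<in> visiting \<gamma> c \<sigma> T None z \<omega> \<and> (\<forall>y. y \<noteq> z \<longrightarrow> t \<notin> visiting \<gamma> c \<sigma> T None y \<omega>)"
proof (cases "\<exists>!y. t \<in> visiting \<gamma> c \<sigma> T None y \<omega>")
  case True
  then obtain y where y: "t \<in> visiting \<gamma> c \<sigma> T None y \<omega>"
    "\<And>y'. t \<in> visiting \<gamma> c \<sigma> T None y' \<omega> \<Longrightarrow> y' = y" by blast
  have "(THE y. t \<in> visiting \<gamma> c \<sigma> T None y \<omega>) = y" by (rule the_equality) (fact y)+
  then have "K_process \<gamma> c \<sigma> T None t \<omega> = Some y"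
    using True assms by (simp add: K_process_def ext_gam_def)
  then show ?thesis using y by (metis option.inject)
next
  case False
  then have "K_process \<gamma> c \<sigma> T None t \<omega> = None"
    using assms by (simp add: K_process_def ext_gam_def)
  then show ?thesis using False by (metis option.distinct(1))
qed

text \<open>
  Needed for the lower bound: the measure of a nonmeasurable set would be 0.
\<close>

lemma K_process_event [measurable]:
  assumes "0 \<le> t"
  shows "{\<omega> \<in> space M. K_process \<gamma> c \<sigma> T None t \<omega> = Some z} \<in> events"
  unfolding K_process_eq_Some_iff[OF assms]
  by (intro predE pred_intros_logic pred_intros_countable visiting_measurable) simp

section \<open>The upper bound\<close>

text \<open>
  A visit of \<open>x\<close> at time \<open>t\<close> begins at a clock value of at most \<open>t\<close>, and the clock is at least
  \<open>c * r\<close> at \<open>r\<close>; hence \<open>x\<close> has a mark by time \<open>t / c\<close>.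
\<close>

lemma trans_prob_le:
  assumes "0 < c" "0 < t"
  shows "trans_prob M \<gamma> c \<sigma> T None (Some x) t / t \<le> lam x / c"
proof -
  let ?u = "t / c"
  have u: "0 < ?u" using assms by simp
  have "trans_prob M \<gamma> c \<sigma> T None (Some x) t \<le> prob {\<omega> \<in> space M. 1 \<le> N x ?u \<omega>}"
    unfolding trans_prob_def
  proof (rule finite_measure_mono)
    show "{\<omega> \<in> space M. K_process \<gamma> c \<sigma> T None t \<omega> = Some x} \<subseteq> {\<omega> \<in> space M. 1 \<le> N x ?u \<omega>}"
    proof safe
      fix \<omega> assume \<omega>: "\<omega> \<in> space M" and "K_process \<gamma> c \<sigma> T None t \<omega> = Some x"
      then obtain i where i: "1 \<le> i" "\<And>r. r < \<sigma> x i \<omega> \<Longrightarrow> Gam \<omega> r \<le> ennreal t"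
        using assms by (auto simp: K_process_eq_Some_iff visiting_iff)
      have "\<sigma> x i \<omega> \<le> ?u"
      proof (rule ccontr)
        assume "\<not> \<sigma> x i \<omega> \<le> ?u"
        then obtain r where r: "?u < r" "r < \<sigma> x i \<omega>" using dense by (auto simp: not_le)
        have "ennreal (c * r) \<le> Gam \<omega> r" by (simp add: clock_None)
        also have "\<dots> \<le> ennreal t" by (intro i r)
        finally have "c * r \<le> t" using assms by (simp add: ennreal_le_iff)
        with r assms show False by (simp add: field_simps)
      qed
      moreover have "\<sigma> x 1 \<omega> \<le> \<sigma> x i \<omega>"
        using marks_le_iff[OF poisson \<omega>, of 1 i] i by simp
      ultimately show "1 \<le> N x ?u \<omega>"
        using le_mark_count_iff[OF poisson \<omega>, of 1] by simp
    qed
  qed measurable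
  also have "\<dots> = 1 - exp (- (lam x * ?u))"
    by (rule prob_mark_count_pos[OF poisson u lam_pos prob_space_axioms])
  also have "\<dots> \<le> lam x * ?u"
    using exp_ge_add_one_self[of "- (lam x * ?u)"] by linarith
  finally show ?thesis using assms by (simp add: field_simps)
qed

section \<open>Independence of counts and holding times\<close>

definition counting_algebra :: "'w measure" where
  "counting_algebra = vimage_algebra (space M) (\<lambda>\<omega> x. \<lambda>t\<in>{0..}. N x t \<omega>)
            (PiM UNIV (\<lambda>_. PiM {0..} (\<lambda>_. count_space UNIV)))"

definition exponential_algebra :: "'w measure" where
  "exponential_algebra = vimage_algebra (space M) (\<lambda>\<omega>. \<lambda>j\<in>T_index. T j \<omega>) (PiM T_index (\<lambda>_. borel))"

lemma space_counting_exponential [simp]: "space counting_algebra = space M"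
  "space exponential_algebra = space M"
  by (simp_all add: counting_algebra_def exponential_algebra_def)

lemma indep_counting_exponential: "indep_set (sets counting_algebra) (sets exponential_algebra)"
  using families_indep by (simp add: counting_algebra_def exponential_algebra_def)

lemma measurable_N_counting:
  assumes "0 \<le> t"
  shows "N z t \<in> measurable counting_algebra (count_space UNIV)"
proof -
  have 1: "(\<lambda>\<omega> x. \<lambda>t\<in>{0..}. N x t \<omega>) \<in> measurable counting_algebra (PiM UNIV (\<lambda>_. PiM {0..} (\<lambda>_. count_space UNIV)))"
    unfolding counting_algebra_def by (rule measurable_vimage_algebra1) (auto simp: space_PiM PiE_def extensional_def)
  have 2: "(\<lambda>f. f z t) \<in> measurable (PiM UNIV (\<lambda>_. PiM {0..} (\<lambda>_. count_space UNIV))) (count_space (UNIV :: nat set))"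
    using assms by (intro measurable_compose[OF measurable_component_singleton[of z] measurable_component_singleton]) auto
  show ?thesis using measurable_compose[OF 1 2] assms by simp
qed

lemma count_event_counting:
  assumes "0 \<le> t"
  shows "{\<omega> \<in> space M. k \<le> N z t \<omega>} \<in> sets counting_algebra"
proof -
  have "{\<omega> \<in> space M. k \<le> N z t \<omega>} = N z t -` {k..} \<inter> space counting_algebra" by auto
  then show ?thesis using measurable_sets[OF measurable_N_counting[OF assms]] by simp
qed

lemma measurable_T_exponential:
  assumes "1 \<le> i"
  shows "T (Some (z, i)) \<in> borel_measurable exponential_algebra"
proof -
  have j: "Some (z, i) \<in> T_index" using assms by (auto simp: T_index_def)
  have 1: "(\<lambda>\<omega>. \<lambda>j\<in>T_index. T j \<omega>) \<in> measurable exponential_algebra (PiM T_index (\<lambda>_. borel))"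
    unfolding exponential_algebra_def by (rule measurable_vimage_algebra1) (auto simp: space_PiM)
  show ?thesis using measurable_compose[OF 1 measurable_component_singleton[OF j]] j by simp
qed

lemma nn_integral_T_indicator:
  assumes "A \<in> sets counting_algebra" "1 \<le> i"
  shows "(\<integral>\<^sup>+\<omega>. indicator A \<omega> * ennreal (T (Some (z, i)) \<omega>) \<partial>M) = emeasure M A"
proof -
  have D: "distributed M lborel (T (Some (z, i))) (exponential_density 1)"
    using assms by (intro exponential) (auto simp: T_index_def)
  have [measurable]: "T (Some (z, i)) \<in> borel_measurable exponential_algebra"
    by (rule measurable_T_exponential[OF assms(2)])
  have "(\<integral>\<^sup>+\<omega>. ennreal (T (Some (z, i)) \<omega>) \<partial>M)
      = (\<integral>\<^sup>+y. ennreal (exponential_density 1 y) * ennreal y \<partial>lborel)"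
    by (subst distributed_nn_integral[OF D]) auto
  also have "\<dots> = (\<integral>\<^sup>+y. ennreal (erlang_density 0 1 y * y ^ 1) \<partial>lborel)"
    by (intro nn_integral_cong) (auto simp: ennreal_mult' erlang_density_def)
  also have "\<dots> = 1" by (subst nn_integral_erlang_ith_moment) simp_all
  finally have "(\<integral>\<^sup>+\<omega>. ennreal (T (Some (z, i)) \<omega>) \<partial>M) = 1" .
  moreover have "(\<integral>\<^sup>+\<omega>. indicator A \<omega> * ennreal (T (Some (z, i)) \<omega>) \<partial>M)
      = emeasure M A * (\<integral>\<^sup>+\<omega>. ennreal (T (Some (z, i)) \<omega>) \<partial>M)"
    by (rule nn_integral_indicator_mult_indep[OF indep_counting_exponential assms(1)]) auto
  ultimately show ?thesis by simp
qed

text \<open>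
  Differences of two coordinates are measurable functions of a whole path, so the independence of
  the paths passes to them.
\<close>

lemma increments_indep:
  assumes "z \<noteq> y" "0 \<le> a" "a \<le> b"
  shows "prob ({\<omega> \<in> space M. k \<le> N z b \<omega> - N z a \<omega>} \<inter> {\<omega> \<in> space M. l \<le> N y b \<omega> - N y a \<omega>})
      = prob {\<omega> \<in> space M. k \<le> N z b \<omega> - N z a \<omega>} * prob {\<omega> \<in> space M. l \<le> N y b \<omega> - N y a \<omega>}"
proof -
  have ab: "(\<lambda>f. f a) \<in> measurable (PiM {0..} (\<lambda>_. count_space UNIV)) (count_space (UNIV :: nat set))"
    "(\<lambda>f. f b) \<in> measurable (PiM {0..} (\<lambda>_. count_space UNIV)) (count_space (UNIV :: nat set))"
    using assms by (auto intro!: measurable_component_singleton)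
  have "(\<lambda>f. f b - f a) \<in> measurable (PiM {0..} (\<lambda>_. count_space UNIV)) (count_space (UNIV :: nat set))"
    by (rule measurable_compose_countable[where g = "\<lambda>f. f b" and f = "\<lambda>m f. m - f a"])
       (auto intro: ab measurable_compose[OF ab(1)])
  then have "indep_vars (\<lambda>_. count_space UNIV)
      (\<lambda>x \<omega>. (\<lambda>f. f b - f a) (\<lambda>t\<in>{0..}. N x t \<omega>)) UNIV"
    by (rule indep_vars_compose2[OF poisson_indep])
  then have *: "indep_vars (\<lambda>_. count_space UNIV) (\<lambda>x \<omega>. N x b \<omega> - N x a \<omega>) UNIV"
    using assms by simp
  have "prob (\<Inter>x\<in>{z, y}. (\<lambda>\<omega>. N x b \<omega> - N x a \<omega>) -` (if x = z then {k..} else {l..}) \<inter> space M)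
    = (\<Prod>x\<in>{z, y}. prob ((\<lambda>\<omega>. N x b \<omega> - N x a \<omega>) -` (if x = z then {k..} else {l..}) \<inter> space M))"
    by (rule indep_varsD[OF *]) auto
  moreover have "(\<lambda>\<omega>. N x b \<omega> - N x a \<omega>) -` {m..} \<inter> space M = {\<omega> \<in> space M. m \<le> N x b \<omega> - N x a \<omega>}" for x m
    by auto
  ultimately show ?thesis using assms by simp
qed

lemma counts_indep:
  assumes "z \<noteq> y" "0 \<le> t"
  shows "prob ({\<omega> \<in> space M. k \<le> N z t \<omega>} \<inter> {\<omega> \<in> space M. l \<le> N y t \<omega>})
      = prob {\<omega> \<in> space M. k \<le> N z t \<omega>} * prob {\<omega> \<in> space M. l \<le> N y t \<omega>}"
proof -
  have *: "{\<omega> \<in> space M. k \<le> N z t \<omega>} = {\<omega> \<in> space M. k \<le> N z t \<omega> - N z 0 \<omega>}" for z k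
    by (auto simp: mark_count_0[OF poisson])
  show ?thesis unfolding * by (intro increments_indep assms) simp
qed

text \<open>
  Wald's identity for the jumps of \<open>z\<close>, restricted to the event that \<open>N x\<close> has a mark.  The factor
  \<open>emeasure M {\<omega> \<in> space M. 1 \<le> N x u \<omega>}\<close>, of order \<open>u\<close>, is what makes the error terms negligible
  relative to the main term.
\<close>

lemma nn_integral_jumps:
  assumes "z \<noteq> x" "0 < u"
  shows "(\<integral>\<^sup>+\<omega>. indicator {\<omega> \<in> space M. 1 \<le> N x u \<omega>} \<omega> * jumps z u \<omega> \<partial>M)
    = emeasure M {\<omega> \<in> space M. 1 \<le> N x u \<omega>} * ennreal (u * (lam z * \<gamma> z))"
proof -
  define A where "A = {\<omega> \<in> space M. 1 \<le> N x u \<omega>}"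
  define B where "B k = {\<omega> \<in> space M. Suc k \<le> N z u \<omega>}" for k
  have alg: "A \<in> sets counting_algebra" "B k \<in> sets counting_algebra" for k
    using assms by (auto simp: A_def B_def intro!: count_event_counting)
  have ev [measurable]: "A \<in> events" "B k \<in> events" for k
    unfolding A_def B_def by measurable
  have [measurable]: "T (Some (z, Suc k)) \<in> borel_measurable M" for k
    by (rule measurable_T) simp
  have T: "(\<integral>\<^sup>+\<omega>. indicator (A \<inter> B k) \<omega> * ennreal (T (Some (z, Suc k)) \<omega>) \<partial>M) = emeasure M (A \<inter> B k)" for k
    by (intro nn_integral_T_indicator sets.Int alg) simp
  have "indicator A \<omega> * jumps z u \<omega>
      = (\<Sum>k. ennreal (\<gamma> z) * (indicator (A \<inter> B k) \<omega> * ennreal (T (Some (z, Suc k)) \<omega>)))"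
    if "\<omega> \<in> space M" for \<omega>
    unfolding jumps_def sum_atLeast1_conv_suminf ennreal_suminf_cmult[symmetric]
    using that gam_pos[of z]
    by (intro suminf_cong) (auto simp: B_def indicator_def ennreal_mult')
  then have "(\<integral>\<^sup>+\<omega>. indicator A \<omega> * jumps z u \<omega> \<partial>M)
      = (\<integral>\<^sup>+\<omega>. (\<Sum>k. ennreal (\<gamma> z) * (indicator (A \<inter> B k) \<omega> * ennreal (T (Some (z, Suc k)) \<omega>))) \<partial>M)"
    by (rule nn_integral_cong)
  also have "\<dots> = (\<Sum>k. ennreal (\<gamma> z) * emeasure M (A \<inter> B k))"
    by (simp add: nn_integral_suminf nn_integral_cmult T)
  also have "\<dots> = (\<Sum>k. (ennreal (\<gamma> z) * emeasure M A) * emeasure M (B k))"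
    using counts_indep[of x z u 1] assms
    by (simp add: A_def B_def emeasure_eq_measure ennreal_mult mult.assoc)
  also have "\<dots> = (ennreal (\<gamma> z) * emeasure M A) * (\<Sum>k. emeasure M (B k))"
    by simp
  also have "(\<Sum>k. emeasure M (B k)) = (\<integral>\<^sup>+\<omega>. (\<Sum>k. indicator (B k) \<omega>) \<partial>M)"
    by (simp add: nn_integral_suminf)
  also have "\<dots> = (\<integral>\<^sup>+\<omega>. of_nat (N z u \<omega>) \<partial>M)"
  proof (rule nn_integral_cong)
    fix \<omega> assume "\<omega> \<in> space M"
    then have "(\<Sum>k. indicator (B k) \<omega>) = (\<Sum>k. if Suc k \<le> N z u \<omega> then 1 else 0 :: ennreal)"
      by (intro suminf_cong) (auto simp: B_def)
    also have "\<dots> = of_nat (N z u \<omega>)"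
      using sum_atLeast1_conv_suminf[of "\<lambda>_. 1" "N z u \<omega>"] by simp
    finally show "(\<Sum>k. indicator (B k) \<omega>) = (of_nat (N z u \<omega>) :: ennreal)" .
  qed
  also have "\<dots> = ennreal (lam z * u)"
    by (rule nn_integral_mark_count[OF poisson assms(2) lam_pos])
  also have "ennreal (\<gamma> z) * emeasure M A * ennreal (lam z * u) = emeasure M A * ennreal (u * (lam z * \<gamma> z))"
    using assms lam_pos[of z] gam_pos[of z] by (simp add: ennreal_mult mult_ac)
  finally show ?thesis by (simp add: A_def)
qed

section \<open>Distinct Poisson processes have no common marks\<close>

lemma increment_pos:
  assumes "\<omega> \<in> space M" "1 \<le> i" "a < \<sigma> z i \<omega>" "\<sigma> z i \<omega> \<le> b"
  shows "1 \<le> N z b \<omega> - N z a \<omega>"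
  using le_mark_count_iff[OF poisson assms(1,2), of z a] le_mark_count_iff[OF poisson assms(1,2), of z b] assms
  by simp

text \<open>
  Divide \<open>[0, K + 1]\<close> into \<open>n\<close> intervals of length \<open>h\<close>.  A common mark puts a mark of both processes
  into one of them, which has probability at most \<open>n * (lam x * h) * (lam z * h) = O(1 / n)\<close>.
\<close>

lemma AE_no_common_mark:
  assumes "x \<noteq> z"
  shows "AE \<omega> in M. \<forall>i\<ge>1. \<forall>j\<ge>1. \<sigma> x i \<omega> \<noteq> \<sigma> z j \<omega>"
proof -
  have 1: "AE \<omega> in M. \<sigma> x i \<omega> = \<sigma> z j \<omega> \<longrightarrow> \<not> \<sigma> x i \<omega> \<le> real (Suc K)" if i: "1 \<le> i" and j: "1 \<le> j" for i j K
  proof -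
    define Bad where "Bad = {\<omega> \<in> space M. \<sigma> x i \<omega> = \<sigma> z j \<omega> \<and> \<sigma> x i \<omega> \<le> real (Suc K)}"
    note [measurable] = measurable_marks[OF poisson i] measurable_marks[OF poisson j]
    have [measurable]: "Bad \<in> events" unfolding Bad_def by measurable
    define h where "h n = real (Suc K) / real n" for n
    define E where "E y n k = {\<omega> \<in> space M. 1 \<le> N y (real (Suc k) * h n) \<omega> - N y (real k * h n) \<omega>}" for y n k
    have [measurable]: "E y n k \<in> events" for y n k unfolding E_def by measurable
    have le: "prob Bad \<le> (lam x * lam z * (real (Suc K))\<^sup>2) / real n" if n: "1 \<le> n" for n
    proof -
      have h: "0 < h n" using n by (simp add: h_def)
      have "Bad \<subseteq> (\<Union>k<n. E x n k \<inter> E z n k)"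
      proof
        fix \<omega> assume "\<omega> \<in> Bad"
        then have \<omega>: "\<omega> \<in> space M" and eq: "\<sigma> z j \<omega> = \<sigma> x i \<omega>" and le: "\<sigma> x i \<omega> \<le> real (Suc K)"
          by (auto simp: Bad_def)
        define s where "s = \<sigma> x i \<omega> / h n"
        have s: "0 < s" using marks_pos[OF poisson \<omega> i] h by (simp add: s_def)
        \<comment> \<open>The intervals are open on the left, as the increments count the marks in \<open>(a, b]\<close>.\<close>
        define k where "k = nat (\<lceil>s\<rceil> - 1)"
        have k: "real k < s" "s \<le> real (Suc k)" using s unfolding k_def by linarith+
        have "s \<le> real n" using mult_left_mono[OF le, of "real n"] n
          by (simp add: s_def h_def field_simps)
        then have "k < n" using k by linarith
        have "real k * h n < \<sigma> x i \<omega>" "\<sigma> x i \<omega> \<le> real (Suc k) * h n"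
          using k h by (simp_all add: s_def field_simps)
        then have "\<omega> \<in> E x n k \<inter> E z n k"
          using increment_pos[OF \<omega> i, of _ x] increment_pos[OF \<omega> j, of _ z] \<omega> eq by (simp add: E_def)
        then show "\<omega> \<in> (\<Union>k<n. E x n k \<inter> E z n k)" using \<open>k < n\<close> by blast
      qed
      then have "prob Bad \<le> prob (\<Union>k<n. E x n k \<inter> E z n k)"
        by (intro finite_measure_mono) auto
      also have "\<dots> \<le> (\<Sum>k<n. prob (E x n k \<inter> E z n k))"
        by (intro finite_measure_subadditive_finite) auto
      also have "\<dots> \<le> (\<Sum>k<n. (lam x * h n) * (lam z * h n))"
      proof (rule sum_mono)
        fix k
        have k: "0 \<le> real k * h n" "real k * h n < real (Suc k) * h n" using h by (simp_all add: field_simps)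
        have "prob (E y n k) \<le> lam y * h n" for y
          using prob_increment_pos(2)[OF poisson k lam_pos prob_space_axioms, of y]
          by (simp add: E_def algebra_simps)
        moreover have "prob (E x n k \<inter> E z n k) = prob (E x n k) * prob (E z n k)"
          unfolding E_def using k by (intro increments_indep assms) auto
        ultimately show "prob (E x n k \<inter> E z n k) \<le> (lam x * h n) * (lam z * h n)"
          using h lam_pos[of x] by (auto intro!: mult_mono)
      qed
      also have "\<dots> = (lam x * lam z * (real (Suc K))\<^sup>2) / real n"
        using n by (simp add: h_def field_simps power2_eq_square)
      finally show ?thesis .
    qed
    have "(\<lambda>n. (lam x * lam z * (real (Suc K))\<^sup>2) / real n) \<longlonglongrightarrow> 0"
      by (rule lim_const_over_n)
    then have "prob Bad \<le> 0"
      by (rule LIMSEQ_le_const) (use le in blast)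
    then have "prob Bad = 0" by (simp add: measure_le_0_iff)
    then have "AE \<omega> in M. \<omega> \<notin> Bad"
      by (intro AE_not_in) (auto simp: null_sets_def emeasure_eq_measure)
    then show ?thesis using AE_space by eventually_elim (auto simp: Bad_def)
  qed
  have "AE \<omega> in M. \<forall>i j K. 1 \<le> i \<longrightarrow> 1 \<le> j \<longrightarrow> \<sigma> x i \<omega> = \<sigma> z j \<omega> \<longrightarrow> \<not> \<sigma> x i \<omega> \<le> real (Suc K)"
    unfolding AE_all_countable using 1 by auto
  then show ?thesis
  proof eventually_elim
    case (elim \<omega>)
    have "\<exists>K. \<sigma> x i \<omega> \<le> real (Suc K)" for i
    proof -
      obtain K where "\<sigma> x i \<omega> \<le> real K" using real_arch_simple by blast
      then show ?thesis by (intro exI[of _ K]) simp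
    qed
    then show ?case using elim by blast
  qed
qed

section \<open>The lower bound\<close>

definition tail_jumps :: "'s set \<Rightarrow> real \<Rightarrow> 'w \<Rightarrow> ennreal" where
  "tail_jumps F u \<omega> = (\<Sum>\<^sub>\<infinity>z. if z \<in> F then 0 else jumps z u \<omega>)"

lemma measurable_tail_jumps [measurable]: "tail_jumps F u \<in> borel_measurable M"
  unfolding tail_jumps_def
  by (intro borel_measurable_infsum_ennreal infinite_S) measurable

text \<open>
  Markov's inequality on the event that \<open>N x\<close> has a mark in \<open>[0, u]\<close>.  Since \<open>x \<in> F\<close>, the states
  that contribute are different from \<open>x\<close>, and their expected jumps come with the probability of
  this event as a factor.
\<close>

lemma prob_tail_jumps_gt:
  assumes "0 < u" "0 < \<epsilon>" "x \<in> F"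
    and \<delta>: "\<And>H. finite H \<Longrightarrow> H \<inter> F = {} \<Longrightarrow> (\<Sum>z\<in>H. lam z * \<gamma> z) \<le> \<delta>"
  shows "prob ({\<omega> \<in> space M. 1 \<le> N x u \<omega>} \<inter> {\<omega> \<in> space M. ennreal (\<epsilon> * u) < tail_jumps F u \<omega>})
    \<le> prob {\<omega> \<in> space M. 1 \<le> N x u \<omega>} * (\<delta> / \<epsilon>)"
proof -
  define A where "A = {\<omega> \<in> space M. 1 \<le> N x u \<omega>}"
  have [measurable]: "A \<in> events" unfolding A_def by measurable
  have \<delta>0: "0 \<le> \<delta>" using \<delta>[of "{}"] by simp
  have "(\<integral>\<^sup>+\<omega>. indicator A \<omega> * tail_jumps F u \<omega> \<partial>M)
      = (\<integral>\<^sup>+\<omega>. (\<Sum>\<^sub>\<infinity>z. if z \<in> F then 0 else indicator A \<omega> * jumps z u \<omega>) \<partial>M)"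
    unfolding tail_jumps_def infsum_ennreal_suminf[OF infinite_S] ennreal_suminf_cmult[symmetric]
    by (intro nn_integral_cong suminf_cong) auto
  also have "\<dots> = (\<Sum>\<^sub>\<infinity>z. \<integral>\<^sup>+\<omega>. (if z \<in> F then 0 else indicator A \<omega> * jumps z u \<omega>) \<partial>M)"
    by (intro nn_integral_infsum infinite_S) measurable
  also have "\<dots> = (\<Sum>\<^sub>\<infinity>z. if z \<in> F then 0 else emeasure M A * ennreal (u * (lam z * \<gamma> z)))"
    using assms(1,3) by (intro infsum_cong) (auto simp: A_def intro!: nn_integral_jumps[simplified])
  also have "\<dots> \<le> ennreal (prob A * (u * \<delta>))"
  proof (rule infsum_ennreal_le)
    fix H :: "'s set" assume "finite H"
    have "(\<Sum>z\<in>H. if z \<in> F then 0 else emeasure M A * ennreal (u * (lam z * \<gamma> z)))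
        = (\<Sum>z\<in>H - F. emeasure M A * ennreal (u * (lam z * \<gamma> z)))"
      using \<open>finite H\<close> by (simp add: sum.If_cases Diff_eq)
    also have "\<dots> = (\<Sum>z\<in>H - F. ennreal (prob A * (u * (lam z * \<gamma> z))))"
      by (simp add: emeasure_eq_measure ennreal_mult')
    also have "\<dots> = ennreal (\<Sum>z\<in>H - F. prob A * (u * (lam z * \<gamma> z)))"
      using lam_pos gam_pos assms(1) by (intro sum_ennreal) (simp add: less_imp_le)
    also have "(\<Sum>z\<in>H - F. prob A * (u * (lam z * \<gamma> z))) = prob A * (u * (\<Sum>z\<in>H - F. lam z * \<gamma> z))"
      by (simp add: sum_distrib_left)
    also have "ennreal \<dots> \<le> ennreal (prob A * (u * \<delta>))"
      using \<open>finite H\<close> assms(1) by (intro ennreal_leI mult_left_mono \<delta>) auto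
    finally show "(\<Sum>z\<in>H. if z \<in> F then 0 else emeasure M A * ennreal (u * (lam z * \<gamma> z)))
        \<le> ennreal (prob A * (u * \<delta>))" .
  qed
  finally have E: "(\<integral>\<^sup>+\<omega>. indicator A \<omega> * tail_jumps F u \<omega> \<partial>M) \<le> ennreal (prob A * (u * \<delta>))" .
  let ?C = "A \<inter> {\<omega> \<in> space M. ennreal (\<epsilon> * u) < tail_jumps F u \<omega>}"
  have [measurable]: "?C \<in> events" by measurable
  have "ennreal (\<epsilon> * u * prob ?C) = (\<integral>\<^sup>+\<omega>. ennreal (\<epsilon> * u) * indicator ?C \<omega> \<partial>M)"
    using assms by (simp add: nn_integral_cmult emeasure_eq_measure ennreal_mult)
  also have "\<dots> \<le> (\<integral>\<^sup>+\<omega>. indicator A \<omega> * tail_jumps F u \<omega> \<partial>M)"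
    by (intro nn_integral_mono) (auto simp: indicator_def)
  also note E
  finally have "\<epsilon> * u * prob ?C \<le> prob A * (u * \<delta>)"
    using assms(1) \<delta>0 by (simp add: ennreal_le_iff)
  then show ?thesis using assms by (simp add: A_def field_simps)
qed

text \<open>
  Before the first mark of \<open>x\<close> the clock collects only drift and the jumps of the other states, at
  most \<open>c * u + \<epsilon> * u = t\<close>; the first jump of \<open>x\<close> alone carries it past \<open>t\<close>.  Any other state
  visited at time \<open>t\<close> would have a mark at which the clock crosses \<open>t\<close>, and by monotonicity this can
  only be the same mark.
\<close>

lemma visits_x:
  assumes \<omega>: "\<omega> \<in> space M"
    and u: "0 < u" "0 < \<epsilon>" and t: "t = (c + \<epsilon>) * u"
    and A: "1 \<le> N x u \<omega>"
    and B: "t < \<gamma> x * T (Some (x, 1)) \<omega>"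
    and C: "tail_jumps {x} u \<omega> \<le> ennreal (\<epsilon> * u)"
    and D: "\<And>z i j. z \<noteq> x \<Longrightarrow> 1 \<le> i \<Longrightarrow> 1 \<le> j \<Longrightarrow> \<sigma> x i \<omega> \<noteq> \<sigma> z j \<omega>"
  shows "K_process \<gamma> c \<sigma> T None t \<omega> = Some x"
proof -
  let ?s = "\<sigma> x 1 \<omega>"
  have t0: "0 \<le> t" using t u c_nonneg by simp
  have su: "?s \<le> u" using le_mark_count_iff[OF poisson \<omega>, of 1] A by simp
  have before: "Gam \<omega> r \<le> ennreal t" if "r < ?s" for r
  proof -
    have "N x r \<omega> = 0" using le_mark_count_iff[OF poisson \<omega>, of 1 x r] that by simp
    then have "(\<Sum>\<^sub>\<infinity>z. jumps z r \<omega>) \<le> tail_jumps {x} u \<omega>"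
      unfolding tail_jumps_def using that su
      by (intro infsum_mono nonneg_summable_on_complete) (auto simp: jumps_def[of x] jumps_mono[OF \<omega>])
    then have "Gam \<omega> r \<le> ennreal (\<epsilon> * u) + ennreal (c * u)"
      unfolding clock_None using that su c_nonneg C
      by (intro add_mono ennreal_leI mult_left_mono) auto
    also have "\<dots> = ennreal t"
      using u c_nonneg by (simp add: t ennreal_plus[symmetric] algebra_simps del: ennreal_plus)
    finally show ?thesis .
  qed
  have "N x ?s \<omega> \<ge> 1" using le_mark_count_iff[OF poisson \<omega>, of 1 x ?s] by simp
  then have "ennreal (\<gamma> x * T (Some (x, 1)) \<omega>) \<le> jumps x ?s \<omega>"
    unfolding jumps_def by (intro member_le_sum[of 1 _ "\<lambda>i. ennreal (\<gamma> x * T (Some (x, i)) \<omega>)"]) auto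
  also have "\<dots> \<le> (\<Sum>\<^sub>\<infinity>z. jumps z ?s \<omega>)" by (rule le_infsum_ennreal)
  also have "\<dots> \<le> Gam \<omega> ?s" by (simp add: clock_None)
  finally have "ennreal (\<gamma> x * T (Some (x, 1)) \<omega>) \<le> Gam \<omega> ?s" .
  then have after: "ennreal t < Gam \<omega> ?s"
    using B t0 by (meson ennreal_lessI less_le_trans order_le_less_trans)
  have "t \<notin> visiting \<gamma> c \<sigma> T None z \<omega>" if z: "z \<noteq> x" for z
  proof
    assume "t \<in> visiting \<gamma> c \<sigma> T None z \<omega>"
    then obtain j where j: "1 \<le> j" "\<And>r. r < \<sigma> z j \<omega> \<Longrightarrow> Gam \<omega> r \<le> ennreal t" "ennreal t < Gam \<omega> (\<sigma> z j \<omega>)"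
      by (auto simp: visiting_iff[OF \<omega>])
    consider "\<sigma> z j \<omega> < ?s" | "?s < \<sigma> z j \<omega>" using D[OF z, of 1 j] j(1) by fastforce
    then show False
    proof cases
      case 1
      with before j(3) show False by (meson leD)
    next
      case 2
      with after j(2) show False by (meson leD)
    qed
  qed
  moreover have "t \<in> visiting \<gamma> c \<sigma> T None x \<omega>"
    using before after by (auto simp: visiting_iff[OF \<omega>] intro!: exI[of _ "1 :: nat"])
  ultimately show ?thesis using t0 by (simp add: K_process_eq_Some_iff)
qed

text \<open>
  The event \<open>A x\<close> that \<open>N x\<close> has a mark in \<open>[0, u]\<close> is covered, up to a null set, by the visit of
  \<open>x\<close> and three exceptional events inside \<open>A x\<close>: the first holding time of \<open>x\<close> is too short
  (\<open>B\<close>), another state in \<open>F\<close> has a mark (\<open>A z\<close>), or the states outside \<open>F\<close> contribute too much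
  (\<open>C\<close>).  Each of them has probability \<open>prob (A x)\<close> times a small factor.
\<close>

lemma trans_prob_ge:
  assumes u: "0 < u" "0 < \<epsilon>" and t: "t = (c + \<epsilon>) * u" and F: "finite F" "x \<in> F"
    and \<delta>: "\<And>H. finite H \<Longrightarrow> H \<inter> F = {} \<Longrightarrow> (\<Sum>z\<in>H. lam z * \<gamma> z) \<le> \<delta>"
  shows "(1 - exp (- (lam x * u))) * (exp (- (t / \<gamma> x)) - u * (\<Sum>z\<in>F. lam z) - \<delta> / \<epsilon>)
    \<le> trans_prob M \<gamma> c \<sigma> T None (Some x) t"
proof -
  have t0: "0 \<le> t" using t u c_nonneg by simp
  define W where "W = {\<omega> \<in> space M. K_process \<gamma> c \<sigma> T None t \<omega> = Some x}"
  define A where "A z = {\<omega> \<in> space M. 1 \<le> N z u \<omega>}" for z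
  define B where "B = {\<omega> \<in> space M. T (Some (x, 1)) \<omega> \<le> t / \<gamma> x}"
  define C where "C = {\<omega> \<in> space M. ennreal (\<epsilon> * u) < tail_jumps F u \<omega>}"
  have [measurable]: "T (Some (x, 1)) \<in> borel_measurable M" by (rule measurable_T) simp
  have [measurable]: "W \<in> events" "A z \<in> events" "B \<in> events" "C \<in> events" for z
    unfolding W_def A_def B_def C_def using K_process_event[OF t0] by measurable
  have pA: "prob (A z) = 1 - exp (- (lam z * u))" for z
    unfolding A_def by (rule prob_mark_count_pos[OF poisson u(1) lam_pos prob_space_axioms])
  have pAB: "prob (A x \<inter> B) = prob (A x) * (1 - exp (- (t / \<gamma> x)))"
  proof -
    have "B = T (Some (x, 1)) -` {..t / \<gamma> x} \<inter> space exponential_algebra" by (auto simp: B_def)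
    then have "B \<in> sets exponential_algebra" using measurable_sets[OF measurable_T_exponential[of 1 x]] by simp
    moreover have "A x \<in> sets counting_algebra" unfolding A_def using u by (intro count_event_counting) simp
    ultimately have "prob (A x \<inter> B) = prob (A x) * prob B" by (intro indep_setD[OF indep_counting_exponential])
    also have "prob B = 1 - exp (- (t / \<gamma> x) * 1)"
      unfolding B_def using t0 gam_pos[of x]
      by (intro exponential_distributedD_le exponential) (auto simp: T_index_def less_imp_le)
    finally show ?thesis by simp
  qed
  have pAA: "prob (\<Union>z\<in>F - {x}. A x \<inter> A z) \<le> prob (A x) * (u * (\<Sum>z\<in>F. lam z))"
  proof -
    have "prob (\<Union>z\<in>F - {x}. A x \<inter> A z) \<le> (\<Sum>z\<in>F - {x}. prob (A x \<inter> A z))"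
      using F by (intro finite_measure_subadditive_finite) auto
    also have "\<dots> \<le> (\<Sum>z\<in>F - {x}. prob (A x) * (u * lam z))"
    proof (rule sum_mono)
      fix z assume "z \<in> F - {x}"
      then have "prob (A x \<inter> A z) = prob (A x) * prob (A z)"
        unfolding A_def using u by (intro counts_indep) auto
      also have "\<dots> \<le> prob (A x) * (u * lam z)"
        unfolding pA[of z] using exp_ge_add_one_self[of "- (lam z * u)"]
        by (intro mult_left_mono) (auto simp: mult.commute)
      finally show "prob (A x \<inter> A z) \<le> prob (A x) * (u * lam z)" .
    qed
    also have "\<dots> \<le> (\<Sum>z\<in>F. prob (A x) * (u * lam z))"
      using F u lam_pos by (intro sum_mono2) (auto simp: less_imp_le)
    finally show ?thesis by (simp add: sum_distrib_left)
  qed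
  have pAC: "prob (A x \<inter> C) \<le> prob (A x) * (\<delta> / \<epsilon>)"
    unfolding A_def C_def by (rule prob_tail_jumps_gt[OF u F(2) \<delta>])
  have "AE \<omega> in M. \<forall>z. z \<noteq> x \<longrightarrow> (\<forall>i\<ge>1. \<forall>j\<ge>1. \<sigma> x i \<omega> \<noteq> \<sigma> z j \<omega>)"
    unfolding AE_all_countable using AE_no_common_mark[of x] by auto
  then have "AE \<omega> in M. \<omega> \<in> A x \<longrightarrow> \<omega> \<in> W \<union> (A x \<inter> B) \<union> (\<Union>z\<in>F - {x}. A x \<inter> A z) \<union> (A x \<inter> C)"
  proof eventually_elim
    case (elim \<omega>)
    show ?case
    proof (intro impI, rule ccontr)
      assume \<omega>A: "\<omega> \<in> A x" and n: "\<omega> \<notin> W \<union> (A x \<inter> B) \<union> (\<Union>z\<in>F - {x}. A x \<inter> A z) \<union> (A x \<inter> C)"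
      then have \<omega>: "\<omega> \<in> space M" by (simp add: A_def)
      have "jumps z u \<omega> = 0" if "z \<in> F" "z \<noteq> x" for z
        using that n \<omega> \<omega>A by (auto simp: A_def jumps_def)
      then have "tail_jumps {x} u \<omega> = tail_jumps F u \<omega>"
        unfolding tail_jumps_def using F(2) by (intro infsum_cong) auto
      also have "\<dots> \<le> ennreal (\<epsilon> * u)" using n \<omega> \<omega>A by (auto simp: C_def)
      finally have C: "tail_jumps {x} u \<omega> \<le> ennreal (\<epsilon> * u)" .
      have B: "t < \<gamma> x * T (Some (x, 1)) \<omega>"
        using n \<omega> \<omega>A gam_pos[of x] by (auto simp: B_def field_simps)
      have "\<omega> \<in> W"
        unfolding W_def using visits_x[OF \<omega> u t _ B C] \<omega>A elim \<omega> by (auto simp: A_def)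
      then show False using n by simp
    qed
  qed
  then have "prob (A x) \<le> prob (W \<union> (A x \<inter> B) \<union> (\<Union>z\<in>F - {x}. A x \<inter> A z) \<union> (A x \<inter> C))"
    using F by (intro finite_measure_mono_AE) auto
  also have "\<dots> \<le> prob W + prob (A x \<inter> B) + prob (\<Union>z\<in>F - {x}. A x \<inter> A z) + prob (A x \<inter> C)"
    using F by (intro measure_Un_le[THEN order_trans] add_mono order_refl) auto
  finally have "prob (A x) * (exp (- (t / \<gamma> x)) - u * (\<Sum>z\<in>F. lam z) - \<delta> / \<epsilon>) \<le> prob W"
    using pAB pAA pAC by (simp add: algebra_simps)
  then show ?thesis by (simp add: pA W_def trans_prob_def)
qed

lemma small_tail:
  assumes "0 < \<delta>"
  obtains F where "finite F" "x \<in> F"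
    "\<And>H. finite H \<Longrightarrow> H \<inter> F = {} \<Longrightarrow> (\<Sum>z\<in>H. lam z * \<gamma> z) \<le> \<delta>"
proof -
  let ?f = "\<lambda>z. lam z * \<gamma> z"
  let ?S = "infsum ?f UNIV"
  have pos: "0 \<le> ?f z" for z using lam_pos[of z] gam_pos[of z] by simp
  have "(sum ?f \<longlongrightarrow> ?S) (finite_subsets_at_top UNIV)"
    using has_sum_infsum[OF lam_gam_summable] by (simp add: has_sum_def)
  then have "eventually (\<lambda>F. ?S - \<delta> < sum ?f F) (finite_subsets_at_top UNIV)"
    using assms by (intro order_tendstoD(1)) auto
  then obtain G where G: "finite G" "\<And>F. finite F \<Longrightarrow> G \<subseteq> F \<Longrightarrow> ?S - \<delta> < sum ?f F"
    by (auto simp: eventually_finite_subsets_at_top)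
  show thesis
  proof (rule that[of "insert x G"])
    fix H assume H: "finite H" "H \<inter> insert x G = {}"
    have "sum ?f H + sum ?f (insert x G) = sum ?f (H \<union> insert x G)"
      using H G(1) by (intro sum.union_disjoint[symmetric]) auto
    also have "\<dots> \<le> ?S"
      using H G(1) pos by (intro finite_sum_le_infsum lam_gam_summable) auto
    finally show "sum ?f H \<le> \<delta>"
      using G(2)[of "insert x G"] G(1) by fastforce
  qed (use G in auto)
qed

text \<open>
  The factor \<open>1 - \<epsilon>\<close> comes from allowing the tail of the series \<open>lam z * \<gamma> z\<close> to be \<open>\<epsilon>\<^sup>2\<close>, which
  Markov's inequality turns into a loss of \<open>\<epsilon>\<^sup>2 / \<epsilon>\<close>.
\<close>

lemma eventually_trans_prob_gt:
  assumes \<epsilon>: "0 < \<epsilon>" and r: "r < lam x * (1 - \<epsilon>) / (c + \<epsilon>)"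
  shows "eventually (\<lambda>t. r < trans_prob M \<gamma> c \<sigma> T None (Some x) t / t) (at_right 0)"
proof -
  obtain F where F: "finite F" "x \<in> F"
    "\<And>H. finite H \<Longrightarrow> H \<inter> F = {} \<Longrightarrow> (\<Sum>z\<in>H. lam z * \<gamma> z) \<le> \<epsilon>\<^sup>2"
    using small_tail[of "\<epsilon>\<^sup>2" x] \<epsilon> by auto
  define d where "d = c + \<epsilon>"
  have d: "0 < d" using c_nonneg \<epsilon> by (simp add: d_def)
  define L where "L = (\<Sum>z\<in>F. lam z)"
  define l g where "l = lam x" and "g = \<gamma> x"
  have "0 < l" "0 < g" using lam_pos gam_pos by (auto simp: l_def g_def)
  \<comment> \<open>The lower bound with \<open>u = t / d\<close>, divided by \<open>t\<close>.\<close>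
  define h where "h t = (1 - exp (- (l * (t / d)))) * (exp (- (t / g)) - t / d * L - \<epsilon>\<^sup>2 / \<epsilon>) / t" for t
  have "((\<lambda>t. (1 - exp (- (l * (t / d)))) / t) \<longlongrightarrow> l / d) (at_right 0)"
    unfolding divide_inverse[of l d] using \<open>0 < l\<close> d by real_asymp
  moreover have "((\<lambda>t. exp (- (t / g)) - t / d * L - \<epsilon>) \<longlongrightarrow> exp (- (0 / g)) - 0 / d * L - \<epsilon>) (at_right 0)"
    using \<open>0 < g\<close> d by (intro tendsto_intros) auto
  ultimately have "((\<lambda>t. (1 - exp (- (l * (t / d)))) / t * (exp (- (t / g)) - t / d * L - \<epsilon>))
      \<longlongrightarrow> l / d * (exp (- (0 / g)) - 0 / d * L - \<epsilon>)) (at_right 0)"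
    by (rule tendsto_mult)
  then have "(h \<longlongrightarrow> l * (1 - \<epsilon>) / d) (at_right 0)"
    using \<epsilon> by (simp add: h_def[abs_def] power2_eq_square)
  then have "eventually (\<lambda>t. r < h t) (at_right 0)"
    by (rule order_tendstoD(1)) (use r in \<open>simp add: l_def d_def\<close>)
  then show ?thesis
    using eventually_at_right_less[of 0]
  proof eventually_elim
    case (elim t)
    have "(1 - exp (- (l * (t / d)))) * (exp (- (t / g)) - t / d * L - \<epsilon>\<^sup>2 / \<epsilon>)
        \<le> trans_prob M \<gamma> c \<sigma> T None (Some x) t"
      unfolding l_def g_def L_def
      by (rule trans_prob_ge[OF _ \<epsilon> _ F]) (use elim d in \<open>auto simp: d_def\<close>)
    then have "h t \<le> trans_prob M \<gamma> c \<sigma> T None (Some x) t / t"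
      unfolding h_def using elim by (intro divide_right_mono) auto
    then show ?case using elim by simp
  qed
qed

lemma tendsto_trans_prob:
  "((\<lambda>t. ennreal (trans_prob M \<gamma> c \<sigma> T None (Some x) t / t))
     \<longlongrightarrow> (if c > 0 then ennreal (lam x / c) else \<infinity>)) (at_right 0)"
  (is "(?p \<longlongrightarrow> ?q) _")
proof (rule order_tendstoI)
  fix a assume "a < ?q"
  then have "a < \<top>" by (auto simp: less_top[symmetric] split: if_splits)
  then obtain r where r: "a = ennreal r" "0 \<le> r" by (cases a) auto
  have "eventually (\<lambda>\<epsilon>. r < lam x * (1 - \<epsilon>) / (c + \<epsilon>)) (at_right 0)"
  proof (cases "c > 0")
    case True
    have "((\<lambda>\<epsilon>. lam x * (1 - \<epsilon>) / (c + \<epsilon>)) \<longlongrightarrow> lam x * (1 - 0) / (c + 0)) (at_right 0)"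
      using True by (intro tendsto_intros) auto
    moreover have "r < lam x / c" using \<open>a < ?q\<close> r True by (simp add: ennreal_less_iff)
    ultimately show ?thesis by (intro order_tendstoD(1)) auto
  next
    case False
    define l where "l = lam x"
    have "0 < l" using lam_pos by (simp add: l_def)
    then have "filterlim (\<lambda>\<epsilon>. l * (1 - \<epsilon>) / \<epsilon>) at_top (at_right 0)" by real_asymp
    then show ?thesis using False c_nonneg by (auto simp: filterlim_at_top_dense l_def)
  qed
  then have "eventually (\<lambda>\<epsilon>. 0 < \<epsilon> \<and> r < lam x * (1 - \<epsilon>) / (c + \<epsilon>)) (at_right 0)"
    using eventually_at_right_less[of 0] by eventually_elim auto
  from eventually_happens'[OF _ this] obtain \<epsilon> where "0 < \<epsilon>" "r < lam x * (1 - \<epsilon>) / (c + \<epsilon>)"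
    by auto
  from eventually_trans_prob_gt[OF this] show "eventually (\<lambda>t. a < ?p t) (at_right 0)"
    by eventually_elim (use r in \<open>simp add: ennreal_less_iff\<close>)
next
  fix a assume a: "?q < a"
  then have c: "0 < c" by (auto split: if_splits)
  show "eventually (\<lambda>t. ?p t < a) (at_right 0)"
    using eventually_at_right_less[of 0]
  proof eventually_elim
    case (elim t)
    have "?p t \<le> ennreal (lam x / c)" by (intro ennreal_leI trans_prob_le c elim)
    also have "\<dots> < a" using a c by simp
    finally show ?case .
  qed
qed

end

theorem proposition5p8:
  fixes M :: "'w measure"
    and \<gamma> lam :: "'s::countable \<Rightarrow> real"
    and c :: real
    and \<sigma> :: "'s \<Rightarrow> nat \<Rightarrow> 'w \<Rightarrow> real"
    and T :: "('s \<times> nat) option \<Rightarrow> 'w \<Rightarrow> real"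
    and x :: 's
  assumes "K_data M \<gamma> lam c \<sigma> T"
  shows "((\<lambda>t. ennreal (trans_prob M \<gamma> c \<sigma> T None (Some x) t / t))
            \<longlongrightarrow> rate_from_infinity M \<gamma> c \<sigma> T x) (at_right 0) \<and>
         rate_from_infinity M \<gamma> c \<sigma> T x = (if c > 0 then ennreal (lam x / c) else \<infinity>)"
proof -
  note lim = K_data.tendsto_trans_prob[OF assms, of x]
  then have "rate_from_infinity M \<gamma> c \<sigma> T x = (if c > 0 then ennreal (lam x / c) else \<infinity>)"
    unfolding rate_from_infinity_def by (intro tendsto_Lim) auto
  then show ?thesis using lim by simp
qed

end
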